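(* Let $d\ge3$ and $n>d$. For $2\le k\le d$ define $r_k=\lfloor n^{d-1}(n-1)^{k+1-2^k}\rfloor$. Then every $d$-dimensional latin hypercube $Q$ of order $n$ contains at least $$(d+1)n^{2d}-(d-1)\left(n^{2d-1}+n^d\right)-d\,n^{d+1}+n\sum_{k=2}^{d}\binom{d}{k}(n-d)^{2^k-1}r_k(r_k-1)$$ cuboctahedra.
   Context: A $d$-dimensional latin hypercube of order $n$ is an array $Q=(q_\alpha)$ indexed by $\alpha\in\{0,\ldots,n-1\}^d$ with entries in $\{0,\ldots,n-1\}$ such that any two indices differing in exactly one coordinate carry different symbols. A cuboctahedron in $Q$ is a tuple consisting of $d$ ordered pairs $(a^i_1,a^i_2)$ and $d$ ordered pairs $(b^i_1,b^i_2)$, $i=1,\ldots,d$, of elements of $\{0,\ldots,n-1\}$, such that $q_{a^1_{j_1},\ldots,a^d_{j_d}}=q_{b^1_{j_1},\ldots,b^d_{j_d}}$ for all $j_1,\ldots,j_d\in\{1,2\}$; cuboctahedra are counted as such tuples. *)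

theory Defs
  imports Complex_Main "HOL-Library.FuncSet"
begin

text \<open>Coordinates are numbered \<open>1, \<dots>, d\<close>. An index is an extensional function, so that
  it is determined by its \<open>d\<close> coordinates.\<close>

definition indices :: "nat \<Rightarrow> nat \<Rightarrow> (nat \<Rightarrow> nat) set" where
  "indices d n = {1..d} \<rightarrow>\<^sub>E {0..<n}"

text \<open>Only the values of \<open>Q\<close> on \<open>indices d n\<close> are relevant.\<close>

definition latin_hypercube :: "nat \<Rightarrow> nat \<Rightarrow> ((nat \<Rightarrow> nat) \<Rightarrow> nat) \<Rightarrow> bool" where
  "latin_hypercube d n Q \<longleftrightarrow>
     (\<forall>\<alpha>\<in>indices d n. Q \<alpha> \<in> {0..<n}) \<and>
     (\<forall>\<alpha>\<in>indices d n. \<forall>\<beta>\<in>indices d n.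
        card {i \<in> {1..d}. \<alpha> i \<noteq> \<beta> i} = 1 \<longrightarrow> Q \<alpha> \<noteq> Q \<beta>)"

text \<open>The index \<open>(a\<^sup>1\<^bsub>j 1\<^esub>, \<dots>, a\<^sup>d\<^bsub>j d\<^esub>)\<close> selected by \<open>j\<close> from the pairs
  \<open>a i = (a\<^sup>i\<^sub>1, a\<^sup>i\<^sub>2)\<close>.\<close>

definition corner :: "nat \<Rightarrow> (nat \<Rightarrow> nat \<times> nat) \<Rightarrow> (nat \<Rightarrow> nat) \<Rightarrow> nat \<Rightarrow> nat" where
  "corner d a j = (\<lambda>i\<in>{1..d}. if j i = 1 then fst (a i) else snd (a i))"

definition cuboctahedra ::
  "nat \<Rightarrow> nat \<Rightarrow> ((nat \<Rightarrow> nat) \<Rightarrow> nat) \<Rightarrow> ((nat \<Rightarrow> nat \<times> nat) \<times> (nat \<Rightarrow> nat \<times> nat)) set" where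
  "cuboctahedra d n Q =
     {(a, b). a \<in> {1..d} \<rightarrow>\<^sub>E {0..<n} \<times> {0..<n} \<and>
              b \<in> {1..d} \<rightarrow>\<^sub>E {0..<n} \<times> {0..<n} \<and>
              (\<forall>j \<in> {1..d} \<rightarrow>\<^sub>E {1, 2}. Q (corner d a j) = Q (corner d b j))}"

end

theory Submission
  imports Defs
begin

text \<open>Group the \<open>d\<close>-tuples of pairs \<open>a\<close> by the set \<open>D\<close> of coordinates in which the pair is
  nondegenerate and by the resulting pattern of symbols. A pattern is a proper colouring of the
  \<open>k\<close>-dimensional cube graph, \<open>k = |D|\<close>, so there are between \<open>n (n - k)\<^bsup>2^k - 1\<^esup>\<close> and
  \<open>n (n - 1)\<^bsup>2^k - 1\<^esup>\<close> of them, while \<open>D\<close> carries exactly \<open>n\<^bsup>d\<^esup> (n - 1)\<^bsup>k\<^esup>\<close> tuples. Two tuples with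
  the same \<open>D\<close> and the same pattern form a cuboctahedron, and convexity bounds the number of such
  pairs from below. For \<open>k \<le> 1\<close> all pairs are bounded together; for \<open>k \<ge> 2\<close> the diagonal pairs
  are counted exactly and convexity is applied to the others.\<close>

subsection \<open>Proper colourings of cube graphs\<close>

definition colorings :: "'v set \<Rightarrow> ('v \<Rightarrow> 'v \<Rightarrow> bool) \<Rightarrow> nat \<Rightarrow> ('v \<Rightarrow> nat) set" where
  "colorings V E n = {c \<in> V \<rightarrow>\<^sub>E {0..<n}. \<forall>u\<in>V. \<forall>v\<in>V. E u v \<longrightarrow> c u \<noteq> c v}"

lemma finite_colorings: "finite V \<Longrightarrow> finite (colorings V E n)"
  by (rule finite_subset[of _ "V \<rightarrow>\<^sub>E {0..<n}"]) (auto simp: colorings_def intro: finite_PiE)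

lemma colorings_empty: "colorings {} E n = {\<lambda>_. undefined}"
  by (auto simp: colorings_def)

text \<open>A proper colouring of the larger graph is a proper colouring \<open>c\<close> of
  \<open>V\<close> together with a colour for \<open>v\<close> absent from its neighbours. The
  number of forbidden colours depends on \<open>c\<close>, since neighbours may share a colour,
  hence a sum instead of a product.\<close>

lemma card_colorings_insert:
  assumes "finite V" "v \<notin> V" "symp E" "\<not> E v v"
  shows "card (colorings (insert v V) E n) =
    (\<Sum>c\<in>colorings V E n. n - card (c ` {u \<in> V. E u v}))"
proof -
  let ?S = "SIGMA c:colorings V E n. {0..<n} - c ` {u \<in> V. E u v}"
  have sym: "E v u \<longleftrightarrow> E u v" for u
    using \<open>symp E\<close> by (auto dest: sympD)
  have "bij_betw (\<lambda>(c, x). c(v := x)) ?S (colorings (insert v V) E n)"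
  proof (rule bij_betw_byWitness[where f' = "\<lambda>c. (restrict c V, c v)"])
    show "\<forall>p\<in>?S. (restrict ((\<lambda>(c, x). c(v := x)) p) V, ((\<lambda>(c, x). c(v := x)) p) v) = p"
      using \<open>v \<notin> V\<close> by (auto simp: colorings_def PiE_def extensional_def restrict_def fun_eq_iff)
    show "\<forall>c\<in>colorings (insert v V) E n. (\<lambda>(c, x). c(v := x)) (restrict c V, c v) = c"
      by (auto simp: colorings_def PiE_def extensional_def restrict_def fun_eq_iff)
    show "(\<lambda>(c, x). c(v := x)) ` ?S \<subseteq> colorings (insert v V) E n"
    proof safe
      fix c x
      assume c: "c \<in> colorings V E n" and x: "x \<in> {0..<n}" "x \<notin> c ` {u \<in> V. E u v}"
      have neq: "c u \<noteq> x" if "u \<in> V" "E u v" for u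
        using x(2) that by blast
      have "c \<in> V \<rightarrow>\<^sub>E {0..<n}"
        using c by (simp add: colorings_def)
      then have "c(v := x) \<in> insert v V \<rightarrow>\<^sub>E {0..<n}"
        using PiE_fun_upd[of x "\<lambda>_. {0..<n}" v c V] x(1) by simp
      moreover have "(c(v := x)) u \<noteq> (c(v := x)) w"
        if "u \<in> insert v V" "w \<in> insert v V" "E u w" for u w
      proof -
        consider "u = v" "w \<in> V" "E w v" "w \<noteq> v" | "w = v" "u \<in> V" "E u v" "u \<noteq> v"
          | "u \<in> V" "w \<in> V" "u \<noteq> v" "w \<noteq> v"
          using \<open>u \<in> insert v V\<close> \<open>w \<in> insert v V\<close> \<open>E u w\<close> assms(2,4) sym by blast
        then show ?thesis
        proof cases
          case 1
          then show ?thesis using neq[of w] by simp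
        next
          case 2
          then show ?thesis using neq[of u] by simp
        next
          case 3
          moreover have "c u \<noteq> c w"
            using c 3 \<open>E u w\<close> unfolding colorings_def by blast
          ultimately show ?thesis by simp
        qed
      qed
      ultimately show "c(v := x) \<in> colorings (insert v V) E n"
        unfolding colorings_def by blast
    qed
    show "(\<lambda>c. (restrict c V, c v)) ` colorings (insert v V) E n \<subseteq> ?S"
    proof (rule image_subsetI)
      fix c assume c: "c \<in> colorings (insert v V) E n"
      then have "restrict c V \<in> colorings V E n"
        by (simp add: colorings_def PiE_def Pi_def)
      moreover have "c v \<in> {0..<n}"
        using c by (simp add: colorings_def PiE_def Pi_def)
      moreover have "c v \<noteq> c u" if "u \<in> V" "E u v" for u
        using c that unfolding colorings_def by fastforce
      ultimately show "(restrict c V, c v) \<in> ?S"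
        by auto
    qed
  qed
  then have "card (colorings (insert v V) E n) = card ?S"
    by (simp add: bij_betw_same_card)
  also have "\<dots> = (\<Sum>c\<in>colorings V E n. card ({0..<n} - c ` {u \<in> V. E u v}))"
    using assms(1) by (simp add: card_SigmaI finite_colorings)
  also have "\<dots> = (\<Sum>c\<in>colorings V E n. n - card (c ` {u \<in> V. E u v}))"
  proof (rule sum.cong[OF refl])
    fix c assume "c \<in> colorings V E n"
    then have "c ` {u \<in> V. E u v} \<subseteq> {0..<n}"
      by (auto simp: colorings_def)
    then show "card ({0..<n} - c ` {u \<in> V. E u v}) = n - card (c ` {u \<in> V. E u v})"
      using assms(1) by (subst card_Diff_subset) auto
  qed
  finally show ?thesis .
qed

text \<open>Vertices of the cube are encoded as subsets; on \<open>Pow D\<close> this is the graph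
  of the cube of dimension \<open>card D\<close>, an edge in direction \<open>x\<close> adding or
  removing \<open>x\<close>.\<close>

definition cube_adj :: "'a set \<Rightarrow> 'a set \<Rightarrow> bool" where
  "cube_adj S T \<longleftrightarrow> (\<exists>x. x \<notin> S \<and> T = insert x S \<or> x \<notin> T \<and> S = insert x T)"

lemma symp_cube_adj: "symp cube_adj"
  by (auto simp: symp_def cube_adj_def)

lemma not_cube_adj_self: "\<not> cube_adj S S"
  by (auto simp: cube_adj_def)

text \<open>In order of increasing cardinality, every nonempty vertex is preceded by at least one and at
  most \<open>|D|\<close> neighbours; downward closed families make this an induction.\<close>

lemma card_colorings_down_closed:
  fixes V :: "'a set set"
  assumes "finite D" "V \<subseteq> Pow D" "V \<noteq> {}" "\<And>S x. S \<in> V \<Longrightarrow> x \<in> S \<Longrightarrow> S - {x} \<in> V"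
  shows "n * (n - card D) ^ (card V - 1) \<le> card (colorings V cube_adj n)"
    and "card (colorings V cube_adj n) \<le> n * (n - 1) ^ (card V - 1)"
proof -
  define B where "B V \<longleftrightarrow> n * (n - card D) ^ (card V - 1) \<le> card (colorings V cube_adj n) \<and>
    card (colorings V cube_adj n) \<le> n * (n - 1) ^ (card V - 1)" for V :: "'a set set"
  have "finite V"
    using assms(1,2) by (meson finite_Pow_iff finite_subset)
  then have "V \<subseteq> Pow D \<longrightarrow> V \<noteq> {} \<longrightarrow> (\<forall>S\<in>V. \<forall>x\<in>S. S - {x} \<in> V) \<longrightarrow> B V"
  proof (induction V rule: finite_ranking_induct[where f = card])
    case empty
    then show ?case by simp
  next
    case (insert X V)
    show ?case
    proof (cases "X \<in> V")
      case True
      then show ?thesis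
        using insert by (simp add: insert_absorb)
    next
      case False
      show ?thesis
      proof (intro impI)
        assume sub: "insert X V \<subseteq> Pow D"
          and down: "\<forall>S\<in>insert X V. \<forall>x\<in>S. S - {x} \<in> insert X V"
        have fin: "finite S" if "S \<in> insert X V" for S
          using sub that assms(1) by (meson PowD finite_subset subsetD)
        \<comment> \<open>\<open>X\<close> has maximal cardinality, so deleting an element from a
          member of \<open>V\<close> cannot produce \<open>X\<close>.\<close>
        have downV: "\<forall>S\<in>V. \<forall>x\<in>S. S - {x} \<in> V"
        proof (intro ballI)
          fix S x assume Sx: "S \<in> V" "x \<in> S"
          then have "card (S - {x}) < card S"
            by (intro psubset_card_mono) (auto intro: fin)
          with insert.hyps Sx have "S - {x} \<noteq> X"
            by (metis linorder_not_less)
          then show "S - {x} \<in> V"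
            using down Sx by blast
        qed
        let ?N = "{u \<in> V. cube_adj u X}"
        \<comment> \<open>An earlier neighbour is not larger than \<open>X\<close>, so it is
          \<open>X\<close> with one element deleted; this leaves at most \<open>card X\<close>
          candidates.\<close>
        have "u \<in> (\<lambda>x. X - {x}) ` X" if "u \<in> ?N" for u
        proof -
          have "\<not> card X < card u"
            using that insert.hyps by (simp add: linorder_not_less)
          then have "\<not> (\<exists>x. x \<notin> X \<and> u = insert x X)"
            using fin[of X] by auto
          then show ?thesis
            using that by (auto simp: cube_adj_def)
        qed
        then have "card ?N \<le> card ((\<lambda>x. X - {x}) ` X)"
          by (intro card_mono) (auto intro: fin)
        also have "\<dots> \<le> card X"
          by (rule card_image_le) (auto intro: fin)
        also have "\<dots> \<le> card D"
          using sub assms(1) by (auto intro: card_mono)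
        finally have "card ?N \<le> card D" .
        then have upper: "card (c ` ?N) \<le> card D" for c :: "'a set \<Rightarrow> nat"
          using card_image_le[of ?N c] \<open>finite V\<close> insert.hyps(1) by simp
        have step: "card (colorings (insert X V) cube_adj n) =
            (\<Sum>c\<in>colorings V cube_adj n. n - card (c ` ?N))"
          by (rule card_colorings_insert[OF insert.hyps(1) False symp_cube_adj not_cube_adj_self])
        show "B (insert X V)"
        \<comment> \<open>The first vertex has no coloured neighbours: it contributes the factor
          \<open>n\<close>, with exponent 0 in both bounds.\<close>
        proof (cases "V = {}")
          case True
          then show ?thesis
            using step by (simp add: B_def colorings_empty)
        next
          case nonempty: False
          then have BV: "B V"
            using insert.IH sub downV by auto
          obtain S0 where S0: "S0 \<in> V"
            using nonempty by blast
          \<comment> \<open>By downward closure a member of least cardinality is empty. So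
            \<open>X\<close>, being new, is nonempty and has an earlier neighbour, which forbids at
            least one colour.\<close>
          obtain S where S: "S \<in> V" "\<forall>T. T \<in> V \<longrightarrow> card S \<le> card T"
            using ex_has_least_nat[of "\<lambda>T. T \<in> V", OF S0, of card] by blast
          have "S = {}"
          proof (rule ccontr)
            assume "S \<noteq> {}"
            then obtain y where y: "y \<in> S"
              by blast
            then have "card (S - {y}) < card S"
              using S(1) by (intro psubset_card_mono) (auto intro: fin)
            then show False
              using S y downV by (meson linorder_not_less)
          qed
          then have "{} \<in> V"
            using S(1) by simp
          with False have "X \<noteq> {}"
            by blast
          then obtain x where x: "x \<in> X"
            by blast
          have "X - {x} \<in> V"
            using down x by (metis Diff_iff insertE insertI1)
          moreover have "cube_adj (X - {x}) X"
            using x by (auto simp: cube_adj_def)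
          ultimately have "?N \<noteq> {}"
            by blast
          then have lower: "1 \<le> card (c ` ?N)" for c :: "'a set \<Rightarrow> nat"
            using insert.hyps(1) by (simp add: Suc_le_eq card_gt_0_iff)
          have card: "card (insert X V) - 1 = Suc (card V - 1)"
            using insert.hyps(1) nonempty False by (simp add: card_gt_0_iff)
          let ?K = "card (colorings V cube_adj n)"
          have "?K * (n - card D) \<le> card (colorings (insert X V) cube_adj n)"
            unfolding step
            using sum_bounded_below[of "colorings V cube_adj n" "n - card D"
                "\<lambda>c. n - card (c ` ?N)"] diff_le_mono2[OF upper]
            by simp
          moreover have "card (colorings (insert X V) cube_adj n) \<le> ?K * (n - 1)"
            unfolding step
            using sum_bounded_above[of "colorings V cube_adj n" "\<lambda>c. n - card (c ` ?N)" "n - 1"]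
              diff_le_mono2[OF lower]
            by simp
          moreover have "n * (n - card D) ^ Suc (card V - 1) \<le> ?K * (n - card D)"
            and "?K * (n - 1) \<le> n * (n - 1) ^ Suc (card V - 1)"
            using BV mult_le_mono1[of _ ?K "n - card D"] mult_le_mono1[of ?K _ "n - 1"]
            by (auto simp: B_def mult_ac)
          ultimately show ?thesis
            unfolding B_def card by linarith
        qed
      qed
    qed
  qed
  then have "B V"
    using assms by blast
  then show "n * (n - card D) ^ (card V - 1) \<le> card (colorings V cube_adj n)"
    and "card (colorings V cube_adj n) \<le> n * (n - 1) ^ (card V - 1)"
    by (simp_all add: B_def)
qed

lemma card_colorings_cube:
  assumes "finite D"
  shows "n * (n - card D) ^ (2 ^ card D - 1) \<le> card (colorings (Pow D) cube_adj n)"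
    and "card (colorings (Pow D) cube_adj n) \<le> n * (n - 1) ^ (2 ^ card D - 1)"
  using card_colorings_down_closed[of D "Pow D" n] assms by (auto simp: card_Pow)

subsection \<open>Convexity\<close>

text \<open>This is the sum of \<open>(m c - r)\<^sup>2\<close> expanded: the square function lies
  above its tangent at \<open>r\<close>. Any integer \<open>r\<close> may thus stand in for the true
  average. The bracketing of the last term exposes \<open>r * int (card C)\<close>, which is later
  compared with the total.\<close>

lemma sum_squares_tangent:
  fixes m :: "'c \<Rightarrow> int"
  shows "0 \<le> (\<Sum>c\<in>C. (m c)\<^sup>2) - 2 * r * (\<Sum>c\<in>C. m c) + r * (r * int (card C))"
proof -
  have "0 \<le> (\<Sum>c\<in>C. (m c - r)\<^sup>2)"
    by (simp add: sum_nonneg)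
  also have "\<dots> = (\<Sum>c\<in>C. (m c)\<^sup>2 - 2 * r * m c + r * r)"
    by (intro sum.cong refl) (simp add: power2_eq_square algebra_simps)
  also have "\<dots> = (\<Sum>c\<in>C. (m c)\<^sup>2) - 2 * r * (\<Sum>c\<in>C. m c) + r * (r * int (card C))"
    by (simp add: sum.distrib sum_subtractf sum_distrib_left sum_distrib_right mult_ac)
  finally show ?thesis .
qed

lemma sum_squares_ge:
  fixes m :: "'c \<Rightarrow> int"
  assumes "0 \<le> r" "r * int (card C) \<le> (\<Sum>c\<in>C. m c)"
  shows "r * (\<Sum>c\<in>C. m c) \<le> (\<Sum>c\<in>C. (m c)\<^sup>2)"
proof -
  let ?N = "\<Sum>c\<in>C. m c"
  have "0 \<le> (\<Sum>c\<in>C. (m c)\<^sup>2) - 2 * r * ?N + r * (r * int (card C))"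
    by (rule sum_squares_tangent)
  also have "\<dots> \<le> (\<Sum>c\<in>C. (m c)\<^sup>2) - 2 * r * ?N + r * ?N"
    using assms by (simp add: mult_left_mono)
  finally show ?thesis by simp
qed

text \<open>A class of size \<open>m\<close> has \<open>m\<close> diagonal pairs and
  \<open>m * (m - 1)\<close> others. Keeping the first exactly and bounding only the second by
  convexity retains the total as a separate term.\<close>

lemma sum_squares_ge_offdiag:
  fixes m :: "'c \<Rightarrow> int"
  assumes "\<And>c. c \<in> C \<Longrightarrow> 0 \<le> m c" "0 \<le> r" "r * int (card C) \<le> (\<Sum>c\<in>C. m c)"
  shows "(\<Sum>c\<in>C. m c) + int (card C) * (r * (r - 1)) \<le> (\<Sum>c\<in>C. (m c)\<^sup>2)"
proof (cases "r = 0")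
  \<comment> \<open>For \<open>r = 0\<close> the factor \<open>2 * r - 1\<close> used in the other
    case is negative; here integrality gives \<open>m \<le> m * m\<close> directly.\<close>
  case True
  have "m c \<le> (m c)\<^sup>2" if "c \<in> C" for c
    using assms(1)[OF that] by (cases "m c = 0") (auto simp: power2_eq_square)
  then show ?thesis
    using True by (simp add: sum_mono)
next
  case False
  let ?N = "\<Sum>c\<in>C. m c"
  have "2 * r * ?N - r * (r * int (card C)) \<le> (\<Sum>c\<in>C. (m c)\<^sup>2)"
    using sum_squares_tangent[of m C r] by linarith
  moreover have "0 \<le> (2 * r - 1) * (?N - r * int (card C))"
    using assms False by (intro mult_nonneg_nonneg) auto
  ultimately show ?thesis
    by (simp add: algebra_simps)
qed

subsection \<open>Tuples of pairs and their patterns\<close>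

text \<open>The subset form of \<open>corner\<close>: \<open>S\<close> collects the coordinates
  where the second entry is taken, so corners become vertices of the cube graph.\<close>

definition select :: "nat \<Rightarrow> (nat \<Rightarrow> nat \<times> nat) \<Rightarrow> nat set \<Rightarrow> nat \<Rightarrow> nat" where
  "select d a S = (\<lambda>i\<in>{1..d}. if i \<in> S then snd (a i) else fst (a i))"

definition tuples :: "nat \<Rightarrow> nat \<Rightarrow> nat set \<Rightarrow> (nat \<Rightarrow> nat \<times> nat) set" where
  "tuples d n D =
     {a \<in> {1..d} \<rightarrow>\<^sub>E {0..<n} \<times> {0..<n}. \<forall>i\<in>{1..d}. fst (a i) \<noteq> snd (a i) \<longleftrightarrow> i \<in> D}"

text \<open>Subsets of \<open>D\<close> suffice as arguments because both entries agree outside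
  \<open>D\<close>; restricting to \<open>Pow D\<close> makes patterns extensional, as colourings
  are.\<close>

definition pattern ::
  "nat \<Rightarrow> ((nat \<Rightarrow> nat) \<Rightarrow> nat) \<Rightarrow> nat set \<Rightarrow> (nat \<Rightarrow> nat \<times> nat) \<Rightarrow> nat set \<Rightarrow> nat" where
  "pattern d Q D a = (\<lambda>S\<in>Pow D. Q (select d a S))"

lemma finite_tuples: "finite (tuples d n D)"
  by (rule finite_subset[of _ "{1..d} \<rightarrow>\<^sub>E {0..<n} \<times> {0..<n}"])
    (auto simp: tuples_def intro: finite_PiE)

text \<open>Coordinates are chosen independently: \<open>n\<close> equal pairs outside
  \<open>D\<close>, \<open>n * (n - 1)\<close> unequal pairs inside.\<close>

lemma card_tuples:
  assumes "D \<subseteq> {1..d}"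
  shows "card (tuples d n D) = n ^ d * (n - 1) ^ card D"
proof -
  let ?diag = "(\<lambda>x. (x, x)) ` {0..<n}"
  let ?A = "\<lambda>i. if i \<in> D then {0..<n} \<times> {0..<n} - ?diag else ?diag"
  have "tuples d n D = (\<Pi>\<^sub>E i\<in>{1..d}. ?A i)"
  proof (intro equalityI subsetI)
    fix a assume a: "a \<in> tuples d n D"
    show "a \<in> (\<Pi>\<^sub>E i\<in>{1..d}. ?A i)"
    proof (rule PiE_I)
      fix i assume "i \<in> {1..d}"
      with a have "a i \<in> {0..<n} \<times> {0..<n}" "fst (a i) \<noteq> snd (a i) \<longleftrightarrow> i \<in> D"
        unfolding tuples_def using PiE_mem[of a "{1..d}" "\<lambda>_. {0..<n} \<times> {0..<n}" i] by simp_all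
      then show "a i \<in> ?A i"
        by (cases "a i") (auto simp: image_iff)
    qed (use a in \<open>auto simp: tuples_def PiE_def extensional_def\<close>)
  next
    fix a assume a: "a \<in> (\<Pi>\<^sub>E i\<in>{1..d}. ?A i)"
    have "a i \<in> {0..<n} \<times> {0..<n} \<and> (fst (a i) \<noteq> snd (a i) \<longleftrightarrow> i \<in> D)" if "i \<in> {1..d}" for i
      using PiE_mem[OF a that] by (auto split: if_splits)
    then show "a \<in> tuples d n D"
      using a by (auto simp: tuples_def PiE_def)
  qed
  then have "card (tuples d n D) = (\<Prod>i\<in>{1..d}. card (?A i))"
    by (simp add: card_PiE)
  also have "\<dots> = (\<Prod>i\<in>{1..d}. n * (if i \<in> D then n - 1 else 1))"
  proof (rule prod.cong[OF refl])
    fix i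
    have "card ?diag = n"
      by (simp add: card_image inj_on_def)
    moreover have "card ({0..<n} \<times> {0..<n} - ?diag) = n * n - n"
      using \<open>card ?diag = n\<close> by (subst card_Diff_subset) auto
    ultimately show "card (?A i) = n * (if i \<in> D then n - 1 else 1)"
      by (simp add: diff_mult_distrib2)
  qed
  also have "\<dots> = n ^ d * (\<Prod>i\<in>{1..d} \<inter> D. n - 1)"
    by (subst prod.inter_restrict) (simp_all add: prod.distrib)
  also have "{1..d} \<inter> D = D"
    using assms by blast
  finally show ?thesis
    by simp
qed

lemma select_in_indices:
  assumes "a \<in> tuples d n D"
  shows "select d a S \<in> indices d n"
proof -
  have "a i \<in> {0..<n} \<times> {0..<n}" if "i \<in> {1..d}" for i
    using assms that PiE_mem[of a "{1..d}" "\<lambda>_. {0..<n} \<times> {0..<n}" i]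
    unfolding tuples_def by blast
  then show ?thesis
    by (auto simp: select_def indices_def mem_Times_iff)
qed

text \<open>Moving along an edge in direction \<open>x \<in> D\<close> changes the index in
  coordinate \<open>x\<close> alone, since the two entries there differ, so the latin property
  forces different symbols.\<close>

lemma pattern_in_colorings:
  assumes "latin_hypercube d n Q" "D \<subseteq> {1..d}" "a \<in> tuples d n D"
  shows "pattern d Q D a \<in> colorings (Pow D) cube_adj n"
proof -
  have idx: "select d a S \<in> indices d n" for S
    by (rule select_in_indices[OF assms(3)])
  have neq: "Q (select d a S) \<noteq> Q (select d a (insert x S))"
    if "insert x S \<subseteq> D" "x \<notin> S" for S x
  proof -
    have "x \<in> D"
      using that(1) by blast
    then have "x \<in> {1..d}" "fst (a x) \<noteq> snd (a x)"
      using assms(2,3) by (auto simp: tuples_def)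
    then have "{i \<in> {1..d}. select d a S i \<noteq> select d a (insert x S) i} = {x}"
      using that(2) by (auto simp: select_def)
    then show ?thesis
      using assms(1) idx unfolding latin_hypercube_def by simp
  qed
  have "Q (select d a S) \<noteq> Q (select d a T)" if "S \<subseteq> D" "T \<subseteq> D" "cube_adj S T" for S T
    using that neq[of _ S] neq[of _ T] unfolding cube_adj_def by metis
  moreover have "Q (select d a S) \<in> {0..<n}" for S
    using assms(1) idx unfolding latin_hypercube_def by blast
  ultimately show ?thesis
    by (auto simp: colorings_def pattern_def)
qed

lemma corner_eq_select:
  assumes "a \<in> tuples d n D"
  shows "corner d a j = select d a {i \<in> D. j i \<noteq> 1}"
  using assms by (auto simp: corner_def select_def tuples_def fun_eq_iff)

text \<open>Every choice \<open>j\<close> yields the same corner as its part inside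
  \<open>D\<close>, so equality of the patterns covers all the required equations.\<close>

lemma cuboctahedra_if_pattern_eq:
  assumes "a \<in> tuples d n D" "b \<in> tuples d n D" "pattern d Q D a = pattern d Q D b"
  shows "(a, b) \<in> cuboctahedra d n Q"
proof -
  have "Q (corner d a j) = Q (corner d b j)" for j
    using fun_cong[OF assms(3), of "{i \<in> D. j i \<noteq> 1}"]
    by (simp add: corner_eq_select[OF assms(1)] corner_eq_select[OF assms(2)] pattern_def)
  then show ?thesis
    using assms(1,2) by (auto simp: cuboctahedra_def tuples_def)
qed

section \<open>Fibres of the pattern map and cuboctahedra as pairs within a fibre\<close>

definition fibre ::
  "nat \<Rightarrow> nat \<Rightarrow> ((nat \<Rightarrow> nat) \<Rightarrow> nat) \<Rightarrow> nat set \<Rightarrow> (nat set \<Rightarrow> nat) \<Rightarrow> (nat \<Rightarrow> nat \<times> nat) set" where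
  "fibre d n Q D c = {a \<in> tuples d n D. pattern d Q D a = c}"

lemma finite_fibre: "finite (fibre d n Q D c)"
  using finite_tuples by (simp add: fibre_def)

text \<open>Every pattern is a proper colouring, so the fibres over proper colourings partition the
  tuples of type \<open>D\<close>.\<close>

lemma sum_card_fibre:
  assumes "latin_hypercube d n Q" "D \<subseteq> {1..d}"
  shows "(\<Sum>c\<in>colorings (Pow D) cube_adj n. card (fibre d n Q D c)) = n ^ d * (n - 1) ^ card D"
proof -
  have "finite (Pow D)"
    using assms(2) finite_subset by auto
  then have "(\<Sum>c\<in>colorings (Pow D) cube_adj n. card (fibre d n Q D c)) = card (tuples d n D)"
    unfolding fibre_def
    using sum.group[OF finite_tuples[of d n D] finite_colorings,
        of "Pow D" "pattern d Q D" cube_adj n "\<lambda>_. 1::nat"]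
      pattern_in_colorings[OF assms] by auto
  then show ?thesis
    by (simp add: card_tuples[OF assms(2)])
qed

text \<open>Each ordered pair from one fibre is a cuboctahedron. No pair is counted twice, because
  its first component alone determines \<open>D\<close> (as \<open>N a\<close>) and then the
  pattern.\<close>

lemma sum_card_fibre_squared_le:
  "(\<Sum>D\<in>Pow {1..d}. \<Sum>c\<in>colorings (Pow D) cube_adj n. (card (fibre d n Q D c))\<^sup>2)
     \<le> card (cuboctahedra d n Q)"
proof -
  let ?I = "SIGMA D:Pow {1..d}. colorings (Pow D) cube_adj n"
  let ?P = "\<lambda>(D, c). fibre d n Q D c \<times> fibre d n Q D c"
  have finD: "finite D" if "D \<in> Pow {1..d}" for D
    using that finite_subset by auto
  then have finI: "finite ?I"
    by (auto intro!: finite_SigmaI finite_colorings)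
  define N where "N a = {i \<in> {1..d}. fst (a i) \<noteq> snd (a i)}" for a :: "nat \<Rightarrow> nat \<times> nat"
  have N: "N a = D" if "a \<in> tuples d n D" "D \<subseteq> {1..d}" for a D
    using that unfolding N_def tuples_def by blast
  have index: "p = (N a, pattern d Q (N a) a)" if "p \<in> ?I" "(a, b) \<in> ?P p" for p a b
  proof -
    obtain D c where p: "p = (D, c)"
      by (cases p)
    then have "a \<in> tuples d n D" "pattern d Q D a = c" "D \<subseteq> {1..d}"
      using that by (simp_all add: fibre_def)
    then show ?thesis
      using N p by metis
  qed
  have disj: "?P p \<inter> ?P q = {}" if "p \<in> ?I" "q \<in> ?I" "p \<noteq> q" for p q
  proof (rule ccontr)
    assume "?P p \<inter> ?P q \<noteq> {}"
    then obtain x where x: "x \<in> ?P p" "x \<in> ?P q"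
      by blast
    obtain a b where "x = (a, b)"
      by (cases x)
    with x have "p = q"
      using index[OF that(1), of a b] index[OF that(2), of a b] by simp
    then show False
      using that(3) by contradiction
  qed
  have "(\<Sum>D\<in>Pow {1..d}. \<Sum>c\<in>colorings (Pow D) cube_adj n. (card (fibre d n Q D c))\<^sup>2)
      = (\<Sum>p\<in>?I. card (?P p))"
    using finD by (subst sum.Sigma)
      (auto simp: finite_colorings card_cartesian_product power2_eq_square intro!: sum.cong)
  also have "\<dots> = card (\<Union>p\<in>?I. ?P p)"
    by (rule card_UN_disjoint[symmetric]) (use finI disj in \<open>auto simp: finite_fibre\<close>)
  also have "\<dots> \<le> card (cuboctahedra d n Q)"
  proof (rule card_mono)
    have "cuboctahedra d n Q \<subseteq> ({1..d} \<rightarrow>\<^sub>E {0..<n} \<times> {0..<n}) \<times> ({1..d} \<rightarrow>\<^sub>E {0..<n} \<times> {0..<n})"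
      by (auto simp: cuboctahedra_def)
    then show "finite (cuboctahedra d n Q)"
      by (rule finite_subset) (auto intro!: finite_PiE)
    show "(\<Union>p\<in>?I. ?P p) \<subseteq> cuboctahedra d n Q"
      by (auto simp: fibre_def intro!: cuboctahedra_if_pattern_eq)
  qed
  finally show ?thesis .
qed

section \<open>Numerical bounds and summation over the type \<open>D\<close>\<close>

lemma sum_Pow_card:
  fixes g :: "nat \<Rightarrow> int"
  assumes "finite A"
  shows "(\<Sum>D\<in>Pow A. g (card D)) = (\<Sum>k\<le>card A. int (card A choose k) * g k)"
proof -
  have "(\<Sum>D\<in>Pow A. g (card D)) = (\<Sum>k\<le>card A. \<Sum>D\<in>{D \<in> Pow A. card D = k}. g (card D))"
    using assms by (intro sum.group[symmetric]) (auto intro: card_mono)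
  also have "\<dots> = (\<Sum>k\<le>card A. int (card A choose k) * g k)"
    by (intro sum.cong refl) (simp add: n_subsets[OF assms])
  finally show ?thesis .
qed

text \<open>The exponent is minus a natural number, so \<open>r\<close> is the floor of a quotient;
  clearing its positive denominator leaves an inequality between integers.\<close>

lemma mult_le_of_floor_powi:
  assumes "k + 1 \<le> 2 ^ k" "1 < n"
    "r = \<lfloor>real n ^ (d - 1) * (real n - 1) powi (int k + 1 - 2 ^ k)\<rfloor>"
  shows "0 \<le> r" "r * (int n - 1) ^ (2 ^ k - 1 - k) \<le> int n ^ (d - 1)"
proof -
  have e: "int k + 1 - 2 ^ k = - int (2 ^ k - 1 - k)"
    using assms(1) by (simp add: of_nat_diff)
  have r: "r = \<lfloor>real n ^ (d - 1) / (real n - 1) ^ (2 ^ k - 1 - k)\<rfloor>"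
    unfolding assms(3) e power_int_minus by (simp add: divide_inverse)
  show "0 \<le> r"
    using assms(2) unfolding r by simp
  have "real_of_int r \<le> real n ^ (d - 1) / (real n - 1) ^ (2 ^ k - 1 - k)"
    unfolding r by (rule of_int_floor_le)
  then have "real_of_int r * (real n - 1) ^ (2 ^ k - 1 - k) \<le> real n ^ (d - 1)"
    using assms(2) by (simp add: pos_le_divide_eq)
  then have "real_of_int (r * (int n - 1) ^ (2 ^ k - 1 - k)) \<le> real_of_int (int n ^ (d - 1))"
    by simp
  then show "r * (int n - 1) ^ (2 ^ k - 1 - k) \<le> int n ^ (d - 1)"
    by linarith
qed

text \<open>Dividing the number of tuples by the upper bound on the number of patterns gives
  \<open>n ^ (d - 1) / (n - 1) ^ (2 ^ k - 1 - k)\<close>. The last assumption thus puts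
  \<open>r\<close> below the average fibre size, and both convexity bounds apply.\<close>

lemma fibre_squares_ge:
  fixes r :: int
  assumes "latin_hypercube d n Q" "D \<subseteq> {1..d}" "card D = k" "0 < d" "d < n"
    and "k + 1 \<le> 2 ^ k" "0 \<le> r" "r * (int n - 1) ^ (2 ^ k - 1 - k) \<le> int n ^ (d - 1)"
  defines "T \<equiv> \<Sum>c\<in>colorings (Pow D) cube_adj n. (int (card (fibre d n Q D c)))\<^sup>2"
  shows "r * (int n ^ d * (int n - 1) ^ k) \<le> T"
    and "int n ^ d * (int n - 1) ^ k + int n * (int n - int d) ^ (2 ^ k - 1) * (r * (r - 1)) \<le> T"
proof -
  let ?C = "colorings (Pow D) cube_adj n"
  have "finite D"
    using assms(2) finite_subset by auto
  have "k \<le> d"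
    using card_mono[OF _ assms(2)] assms(3) by simp
  have n1: "int (n - Suc 0) = int n - 1"
    using assms(5) by simp
  have "(\<Sum>c\<in>?C. int (card (fibre d n Q D c))) = int (n ^ d * (n - 1) ^ k)"
    using sum_card_fibre[OF assms(1,2)] assms(3) by (simp flip: of_nat_sum)
  then have N: "(\<Sum>c\<in>?C. int (card (fibre d n Q D c))) = int n ^ d * (int n - 1) ^ k"
    by (simp add: n1)
  have "int (card ?C) \<le> int (n * (n - 1) ^ (2 ^ k - 1))"
    using card_colorings_cube(2)[OF \<open>finite D\<close>, of n] assms(3) by (simp only: of_nat_le_iff)
  then have "r * int (card ?C) \<le> r * (int n * (int n - 1) ^ (2 ^ k - 1))"
    using assms(7) by (intro mult_left_mono) (simp_all add: n1)
  \<comment> \<open>Splitting off \<open>k\<close> isolates the power bounded by assumption; the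
    remaining factor completes the number of tuples.\<close>
  also have "2 ^ k - 1 = (2 ^ k - 1 - k) + k"
    using assms(6) by simp
  also have "r * (int n * (int n - 1) ^ ((2 ^ k - 1 - k) + k))
      = r * (int n - 1) ^ (2 ^ k - 1 - k) * (int n * (int n - 1) ^ k)"
    by (simp only: power_add mult_ac)
  also have "\<dots> \<le> int n ^ (d - 1) * (int n * (int n - 1) ^ k)"
    using assms(5,8) by (intro mult_right_mono) auto
  also have "\<dots> = int n ^ d * (int n - 1) ^ k"
    using assms(4) by (cases d) simp_all
  finally have avg: "r * int (card ?C) \<le> (\<Sum>c\<in>?C. int (card (fibre d n Q D c)))"
    unfolding N .
  show "r * (int n ^ d * (int n - 1) ^ k) \<le> T"
    using sum_squares_ge[OF assms(7) avg] unfolding N T_def .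
  \<comment> \<open>Replacing \<open>k\<close> by the larger \<open>d\<close> weakens the lower
    bound on the number of patterns to the base \<open>n - d\<close> common to all
    \<open>k\<close>.\<close>
  have "int (n * (n - d) ^ (2 ^ k - 1)) \<le> int (n * (n - k) ^ (2 ^ k - 1))"
    using \<open>k \<le> d\<close> by (intro of_nat_mono mult_left_mono power_mono) auto
  also have "\<dots> \<le> int (card ?C)"
    using card_colorings_cube(1)[OF \<open>finite D\<close>, of n] assms(3) by (simp only: of_nat_le_iff)
  finally have "int n * (int n - int d) ^ (2 ^ k - 1) \<le> int (card ?C)"
    using assms(5) by (simp add: of_nat_diff)
  \<comment> \<open>Nonnegativity, by integrality of \<open>r\<close>, permits replacing the number
    of patterns by its lower bound.\<close>
  moreover have "0 \<le> r * (r - 1)"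
    using assms(7) by (cases "r = 0") auto
  ultimately have "int n * (int n - int d) ^ (2 ^ k - 1) * (r * (r - 1))
      \<le> int (card ?C) * (r * (r - 1))"
    by (rule mult_right_mono)
  then show "int n ^ d * (int n - 1) ^ k + int n * (int n - int d) ^ (2 ^ k - 1) * (r * (r - 1)) \<le> T"
    using sum_squares_ge_offdiag[of ?C "\<lambda>c. int (card (fibre d n Q D c))" r] assms(7) avg
    unfolding N T_def by simp
qed

theorem theorem5:
  fixes d n :: nat and r :: "nat \<Rightarrow> int" and Q :: "(nat \<Rightarrow> nat) \<Rightarrow> nat"
  assumes "d \<ge> 3" and "n > d"
    and "\<And>k. 2 \<le> k \<Longrightarrow> k \<le> d \<Longrightarrow>
           r k = \<lfloor>real n ^ (d - 1) * (real n - 1) powi (int k + 1 - 2 ^ k)\<rfloor>"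
    and "latin_hypercube d n Q"
  shows "int (card (cuboctahedra d n Q)) \<ge>
           (int d + 1) * int n ^ (2 * d)
           - (int d - 1) * (int n ^ (2 * d - 1) + int n ^ d)
           - int d * int n ^ (d + 1)
           + int n * (\<Sum>k = 2..d. int (d choose k) * (int n - int d) ^ (2 ^ k - 1)
                                    * (r k * (r k - 1)))"
proof -
  let ?T = "\<lambda>D. \<Sum>c\<in>colorings (Pow D) cube_adj n. (int (card (fibre d n Q D c)))\<^sup>2"
  let ?e = "\<lambda>k. int n * (int n - int d) ^ (2 ^ k - 1) * (r k * (r k - 1))"
  \<comment> \<open>\<open>g k\<close> bounds the contribution of one \<open>D\<close> of size
    \<open>k\<close>: all pairs at once for \<open>k \<le> 1\<close>, diagonal and other pairs
    separately for \<open>k \<ge> 2\<close>.\<close>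
  define g where "g k = (if k \<le> 1 then int n ^ (d - 1) * (int n ^ d * (int n - 1) ^ k)
    else int n ^ d * (int n - 1) ^ k + ?e k)" for k
  have exp: "k + 1 \<le> 2 ^ k" for k :: nat
    using less_exp[of k] by linarith
  have g_le: "g (card D) \<le> ?T D" if "D \<subseteq> {1..d}" for D
  proof (cases "card D \<le> 1")
    case True
    \<comment> \<open>For sizes 0 and 1 this exponent vanishes, so \<open>n ^ (d - 1)\<close> itself
      is an admissible \<open>r\<close>, with no rounding.\<close>
    then have "2 ^ card D - 1 - card D = (0::nat)"
      by (cases "card D") auto
    then have "int n ^ (d - 1) * (int n - 1) ^ (2 ^ card D - 1 - card D) \<le> int n ^ (d - 1)"
      by (simp only: power_0 mult_1_right order_refl)
    then have "int n ^ (d - 1) * (int n ^ d * (int n - 1) ^ card D) \<le> ?T D"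
      using assms(1) by (intro fibre_squares_ge(1)[OF assms(4) that refl _ assms(2) exp]) simp_all
    then show ?thesis
      using True by (simp only: g_def if_True)
  next
    case False
    moreover have "card D \<le> d"
      using card_mono[OF _ that] by simp
    ultimately have "r (card D) = \<lfloor>real n ^ (d - 1) * (real n - 1) powi (int (card D) + 1 - 2 ^ card D)\<rfloor>"
      by (intro assms(3)) auto
    from mult_le_of_floor_powi[OF exp _ this]
    have "int n ^ d * (int n - 1) ^ card D + ?e (card D) \<le> ?T D"
      using assms(1,2) by (intro fibre_squares_ge(2)[OF assms(4) that refl _ assms(2) exp]) simp_all
    then show ?thesis
      using False by (simp only: g_def if_False)
  qed
  let ?s = "\<lambda>f. \<Sum>k = 2..d. int (d choose k) * f k :: int"
  have split: "(\<Sum>k\<le>d. int (d choose k) * f k) = f 0 + int d * f 1 + ?s f" for f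
  proof -
    have "{..d} = insert 0 (insert 1 {2..d})"
      using assms(1) by auto
    then show ?thesis by simp
  qed
  \<comment> \<open>The binomial theorem for \<open>(n - 1) + 1\<close> evaluates the diagonal
    terms; those with \<open>k = 0\<close> and \<open>k = 1\<close> are then removed.\<close>
  have "(\<Sum>k\<le>d. int (d choose k) * (int n - 1) ^ k) = int n ^ d"
    using binomial_ring[of "int n - 1" 1 d] by simp
  then have binom: "?s (\<lambda>k. (int n - 1) ^ k) = int n ^ d - 1 - int d * (int n - 1)"
    using split[of "\<lambda>k. (int n - 1) ^ k"] by simp
  \<comment> \<open>In terms of \<open>n\<close> and \<open>x\<close> all powers become monomials,
    so the closed form reduces to a polynomial identity.\<close>
  define x where "x = int n ^ (d - 1)"
  have powers: "int n ^ (d - 1) = x" "int n ^ d = int n * x" "int n ^ (2 * d) = int n * x * (int n * x)"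
    "int n ^ (2 * d - 1) = x * (int n * x)" "int n ^ (d + 1) = int n * (int n * x)"
  proof -
    have d: "d = Suc (d - 1)" "2 * d = d + d" and d3: "2 * d - 1 = (d - 1) + d"
      using assms(1) by simp_all
    show "int n ^ (d - 1) = x"
      by (simp add: x_def)
    show N: "int n ^ d = int n * x"
      unfolding x_def using d(1) by (metis power_Suc)
    show "int n ^ (2 * d) = int n * x * (int n * x)"
      unfolding d(2) power_add N ..
    show "int n ^ (2 * d - 1) = x * (int n * x)"
      unfolding d3 power_add N x_def ..
    show "int n ^ (d + 1) = int n * (int n * x)"
      using N by simp
  qed
  have "?s g = ?s (\<lambda>k. int n ^ d * (int n - 1) ^ k + ?e k)"
    by (intro sum.cong) (auto simp: g_def)
  also have "\<dots> = int n ^ d * ?s (\<lambda>k. (int n - 1) ^ k) + ?s ?e"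
    by (simp add: distrib_left sum.distrib sum_distrib_left mult_ac)
  finally have "(\<Sum>k\<le>d. int (d choose k) * g k) =
      int n ^ (d - 1) * int n ^ d + int d * (int n ^ (d - 1) * (int n ^ d * (int n - 1)))
      + int n ^ d * (int n ^ d - 1 - int d * (int n - 1)) + ?s ?e"
    unfolding split binom by (simp add: g_def)
  also have "\<dots> = (int d + 1) * int n ^ (2 * d) - (int d - 1) * (int n ^ (2 * d - 1) - int n ^ d)
           - int d * int n ^ (d + 1) + ?s ?e"
    unfolding powers by (simp add: algebra_simps)
  finally have total: "(\<Sum>k\<le>d. int (d choose k) * g k) = \<dots>" .
  have "(\<Sum>k\<le>d. int (d choose k) * g k) = (\<Sum>D\<in>Pow {1..d}. g (card D))"
    using sum_Pow_card[of "{1..d}" g] by simp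
  also have "\<dots> \<le> (\<Sum>D\<in>Pow {1..d}. ?T D)"
    by (intro sum_mono g_le) auto
  also have "\<dots> \<le> int (card (cuboctahedra d n Q))"
    using of_nat_mono[OF sum_card_fibre_squared_le[of d n Q], where 'a = int] by simp
  finally have "(int d + 1) * int n ^ (2 * d) - (int d - 1) * (int n ^ (2 * d - 1) - int n ^ d)
      - int d * int n ^ (d + 1) + ?s ?e \<le> int (card (cuboctahedra d n Q))"
    unfolding total .
  \<comment> \<open>The sum obtained has \<open>- int n ^ d\<close> inside this bracket; passing to
    \<open>+ int n ^ d\<close> gives up \<open>2 * (d - 1) * n ^ d\<close> and reaches the claimed
    form.\<close>
  moreover have "(int d - 1) * (int n ^ (2 * d - 1) - int n ^ d)
      \<le> (int d - 1) * (int n ^ (2 * d - 1) + int n ^ d)"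
    using assms(1) by (intro mult_left_mono) auto
  moreover have "?s ?e = int n * (\<Sum>k = 2..d. int (d choose k) * (int n - int d) ^ (2 ^ k - 1)
      * (r k * (r k - 1)))"
    by (simp add: sum_distrib_left mult_ac)
  ultimately show ?thesis
    by linarith
qed

end
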